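(* Let $G$ be a semigroup (with identity) and let $f_1,\dots,f_\ell:G\to\mathbb{C}$ be bounded. (1) If $(X,(T_g))$ is a joint Furstenberg system (respectively, a generalised joint Furstenberg system) of $f_1,\dots,f_\ell$ and $(Y,(S_g))$ is topologically isomorphic to $(X,(T_g))$, then $(Y,(S_g))$ is also a joint Furstenberg system (respectively, a generalised joint Furstenberg system) of $f_1,\dots,f_\ell$. (2) Any two joint Furstenberg systems of $f_1,\dots,f_\ell$ are topologically isomorphic. (3) Any joint Furstenberg system of $f_1,\dots,f_\ell$ is a factor of any generalised joint Furstenberg system of $f_1,\dots,f_\ell$, and any generalised joint Furstenberg system of $f_1,\dots,f_\ell$ is a factor of $(\beta G,(\sigma_g)_{g\in G})$.
   Context: Semigroups are discrete and contain an identity element $e$. A topological dynamical $G$-system $(X,(T_g)_{g\in G})$ is a compact Hausdorff space $X$ with continuous maps $T_g:X\to X$ such that $T_{gh}=T_gT_h$ for all $g,h\in G$ and $T_e=\mathrm{id}_X$. A point $a\in X$ is transitive if $\{T_ga:g\in G\}$ is dense in $X$. A factor map from $(X,(T_g))$ to $(Y,(S_g))$ is a continuous surjection $\phi:X\to Y$ with $\phi\circ T_g=S_g\circ\phi$ for all $g$; then $(Y,(S_g))$ is a factor of $(X,(T_g))$. A topological isomorphism is such a $\phi$ that is a homeomorphism. A $G$-system $(X,(T_g))$ is a joint Furstenberg system of bounded $f_1,\dots,f_\ell:G\to\mathbb{C}$ if (i) there exist $F_1,\dots,F_\ell\in C(X)$ and a transitive point $a\in X$ with $F_i(T_ga)=f_i(g)$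 for all $g\in G$ and $i\in\{1,\dots,\ell\}$, and (ii) for any $x\neq y$ in $X$ there exist $g\in G$ and $i\in\{1,\dots,\ell\}$ with $F_i(T_gx)\neq F_i(T_gy)$. Dropping (ii), one speaks of a generalised joint Furstenberg system. $\beta G$ is the Stone–Čech compactification of the discrete space $G$, realised as the space of ultrafilters on $G$ with the topology generated by the sets $\overline{A}=\{p\in\beta G:A\in p\}$, $A\subset G$; $g\in G$ is identified with the principal ultrafilter at $g$. The operation of $G$ extends to $\beta G$ by $p\cdot q=\{A\subset G:\{g\in G:\{h\in G:gh\in A\}\in q\}\in p\}$. For $g\in G$, $\sigma_g:\beta G\to\beta G$ is $\sigma_g(q)=g\cdot q=\{A\subset G:\{h\in G:gh\in A\}\in q\}$. *)

theory Defs
  imports "HOL-Analysis.Analysis"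
begin

text \<open>
  A semigroup with identity is a type \<open>'g :: monoid_mult\<close>. Spaces are carried by values of type
  \<open>'x topology\<close>, so that the underlying set \<open>topspace X\<close> need not be a whole type. Consequently maps
  are total functions on \<open>'x\<close> of which only the values on \<open>topspace X\<close> are relevant.
\<close>

section \<open>Topological dynamical systems\<close>

definition dyn_system :: "'x topology \<Rightarrow> ('g::monoid_mult \<Rightarrow> 'x \<Rightarrow> 'x) \<Rightarrow> bool" where
  "dyn_system X T \<longleftrightarrow>
     compact_space X \<and> Hausdorff_space X \<and>
     (\<forall>g. continuous_map X X (T g)) \<and>
     (\<forall>g h. \<forall>x\<in>topspace X. T (g * h) x = T g (T h x)) \<and>
     (\<forall>x\<in>topspace X. T 1 x = x)"

definition transitive_point :: "'x topology \<Rightarrow> ('g::monoid_mult \<Rightarrow> 'x \<Rightarrow> 'x) \<Rightarrow> 'x \<Rightarrow> bool" where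
  "transitive_point X T a \<longleftrightarrow>
     a \<in> topspace X \<and> X closure_of (range (\<lambda>g. T g a)) = topspace X"

definition factor_map ::
  "'x topology \<Rightarrow> ('g::monoid_mult \<Rightarrow> 'x \<Rightarrow> 'x) \<Rightarrow> 'y topology \<Rightarrow> ('g \<Rightarrow> 'y \<Rightarrow> 'y) \<Rightarrow> ('x \<Rightarrow> 'y) \<Rightarrow> bool"
where
  "factor_map X T Y S \<phi> \<longleftrightarrow>
     dyn_system X T \<and> dyn_system Y S \<and>
     continuous_map X Y \<phi> \<and> \<phi> ` topspace X = topspace Y \<and>
     (\<forall>g. \<forall>x\<in>topspace X. \<phi> (T g x) = S g (\<phi> x))"

text \<open>\<open>(Y, S)\<close> is a factor of \<open>(X, T)\<close>.\<close>

definition is_factor_of ::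
  "'y topology \<Rightarrow> ('g::monoid_mult \<Rightarrow> 'y \<Rightarrow> 'y) \<Rightarrow> 'x topology \<Rightarrow> ('g \<Rightarrow> 'x \<Rightarrow> 'x) \<Rightarrow> bool" where
  "is_factor_of Y S X T \<longleftrightarrow> (\<exists>\<phi>. factor_map X T Y S \<phi>)"

definition topologically_isomorphic ::
  "'x topology \<Rightarrow> ('g::monoid_mult \<Rightarrow> 'x \<Rightarrow> 'x) \<Rightarrow> 'y topology \<Rightarrow> ('g \<Rightarrow> 'y \<Rightarrow> 'y) \<Rightarrow> bool" where
  "topologically_isomorphic X T Y S \<longleftrightarrow>
     (\<exists>\<phi>. factor_map X T Y S \<phi> \<and> homeomorphic_map X Y \<phi>)"

section \<open>Joint Furstenberg systems\<close>

text \<open>The functions \<open>f\<^sub>1, \<dots>, f\<^sub>l\<close> are the values of a family \<open>f\<close> at the indices \<open>1, \<dots>, l\<close>.\<close>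

definition represents ::
  "nat \<Rightarrow> (nat \<Rightarrow> 'g::monoid_mult \<Rightarrow> complex) \<Rightarrow> 'x topology \<Rightarrow> ('g \<Rightarrow> 'x \<Rightarrow> 'x) \<Rightarrow>
   (nat \<Rightarrow> 'x \<Rightarrow> complex) \<Rightarrow> 'x \<Rightarrow> bool" where
  "represents l f X T F a \<longleftrightarrow>
     (\<forall>i\<in>{1..l}. continuous_map X euclidean (F i)) \<and>
     transitive_point X T a \<and>
     (\<forall>g. \<forall>i\<in>{1..l}. F i (T g a) = f i g)"

definition separates_points ::
  "nat \<Rightarrow> 'x topology \<Rightarrow> ('g::monoid_mult \<Rightarrow> 'x \<Rightarrow> 'x) \<Rightarrow> (nat \<Rightarrow> 'x \<Rightarrow> complex) \<Rightarrow> bool" where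
  "separates_points l X T F \<longleftrightarrow>
     (\<forall>x\<in>topspace X. \<forall>y\<in>topspace X. x \<noteq> y \<longrightarrow> (\<exists>g. \<exists>i\<in>{1..l}. F i (T g x) \<noteq> F i (T g y)))"

definition gen_joint_furstenberg_system ::
  "nat \<Rightarrow> (nat \<Rightarrow> 'g::monoid_mult \<Rightarrow> complex) \<Rightarrow> 'x topology \<Rightarrow> ('g \<Rightarrow> 'x \<Rightarrow> 'x) \<Rightarrow> bool" where
  "gen_joint_furstenberg_system l f X T \<longleftrightarrow>
     dyn_system X T \<and> (\<exists>F a. represents l f X T F a)"

definition joint_furstenberg_system ::
  "nat \<Rightarrow> (nat \<Rightarrow> 'g::monoid_mult \<Rightarrow> complex) \<Rightarrow> 'x topology \<Rightarrow> ('g \<Rightarrow> 'x \<Rightarrow> 'x) \<Rightarrow> bool" where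
  "joint_furstenberg_system l f X T \<longleftrightarrow>
     dyn_system X T \<and> (\<exists>F a. represents l f X T F a \<and> separates_points l X T F)"

section \<open>The Stone--Cech compactification\<close>

definition ultrafilter :: "'g set set \<Rightarrow> bool" where
  "ultrafilter p \<longleftrightarrow>
     UNIV \<in> p \<and> {} \<notin> p \<and>
     (\<forall>A B. A \<in> p \<and> A \<subseteq> B \<longrightarrow> B \<in> p) \<and>
     (\<forall>A B. A \<in> p \<and> B \<in> p \<longrightarrow> A \<inter> B \<in> p) \<and>
     (\<forall>A. A \<in> p \<or> - A \<in> p)"

definition beta_topology :: "'g set set topology" where
  "beta_topology = topology_generated_by (range (\<lambda>A. {p. ultrafilter p \<and> A \<in> p}))"

definition principal_uf :: "'g \<Rightarrow> 'g set set" where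
  "principal_uf g = {A. g \<in> A}"

definition beta_mult :: "'g::monoid_mult set set \<Rightarrow> 'g set set \<Rightarrow> 'g set set" where
  "beta_mult p q = {A. {g. {h. g * h \<in> A} \<in> q} \<in> p}"

definition beta_shift :: "'g::monoid_mult \<Rightarrow> 'g set set \<Rightarrow> 'g set set" where
  "beta_shift g q = beta_mult (principal_uf g) q"

lemma beta_shift_eq: "beta_shift g q = {A. {h. g * h \<in> A} \<in> q}"
  by (simp add: beta_shift_def beta_mult_def principal_uf_def)

lemma topspace_beta_topology: "topspace beta_topology = {p :: 'g set set. ultrafilter p}"
  unfolding beta_topology_def topology_generated_by_topspace
  by (auto simp: ultrafilter_def)

end

theory Submission
  imports Defs
begin

text \<open>
  Two systems with transitive points \<open>a\<close> and \<open>b\<close> are compared through the closure \<open>W\<close> of the joint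
  orbit \<open>{(T\<^sub>g a, S\<^sub>g b) | g}\<close>. By compactness both projections of \<open>W\<close> are onto, and as soon as the
  first one is injective, \<open>W\<close> is the graph of a factor map. Injectivity holds when the second system
  is a joint Furstenberg system, because \<open>F\<^sub>i (T\<^sub>g x) = H\<^sub>i (S\<^sub>g y)\<close> extends from the orbit to \<open>W\<close>; and
  it holds when the first system is \<open>\<beta>G\<close>, because disjoint open sets of the second system are
  visited at disjoint sets of times, of which an ultrafilter contains at most one.
\<close>

section \<open>The closure of a joint orbit\<close>

text \<open>This is the orbit closure of \<open>(a, b)\<close> in the product system. Kept as a set
  of pairs, it can be treated as a relation that may turn out to be the graph of a map.\<close>

definition joint_orbit_closure ::
  "'x topology \<Rightarrow> ('g \<Rightarrow> 'x \<Rightarrow> 'x) \<Rightarrow> 'x \<Rightarrow> 'y topology \<Rightarrow> ('g \<Rightarrow> 'y \<Rightarrow> 'y) \<Rightarrow> 'y \<Rightarrow> ('x \<times> 'y) set" where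
  "joint_orbit_closure X T a Y S b = prod_topology X Y closure_of (range (\<lambda>g. (T g a, S g b)))"

lemma dyn_system_mapsto:
  assumes "dyn_system X T" "x \<in> topspace X"
  shows "T g x \<in> topspace X"
  using assms continuous_map_image_subset_topspace unfolding dyn_system_def by fastforce

lemma joint_orbit_closure_subset:
  "joint_orbit_closure X T a Y S b \<subseteq> topspace X \<times> topspace Y"
  unfolding joint_orbit_closure_def by (metis closure_of_subset_topspace topspace_prod_topology)

text \<open>By this symmetry, facts about the first projection also serve for the second
  one.\<close>

lemma joint_orbit_closure_swap:
  assumes "(x, y) \<in> joint_orbit_closure X T a Y S b"
  shows "(y, x) \<in> joint_orbit_closure Y S b X T a"
proof -
  have "prod.swap ` (prod_topology X Y closure_of (range (\<lambda>g. (T g a, S g b))))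
      \<subseteq> prod_topology Y X closure_of (prod.swap ` range (\<lambda>g. (T g a, S g b)))"
    by (rule continuous_map_image_closure_subset)
      (simp add: continuous_map_pairwise comp_def continuous_map_fst continuous_map_snd prod.swap_def)
  moreover have "(y, x) = prod.swap (x, y)" by simp
  ultimately show ?thesis
    using assms unfolding joint_orbit_closure_def image_image by fastforce
qed

text \<open>The projection of the compact closure is compact, hence closed in the Hausdorff space
  \<open>X\<close>, and it contains the dense orbit of \<open>a\<close>.\<close>

lemma joint_orbit_closure_fst:
  assumes X: "dyn_system X T" and Y: "dyn_system Y S"
    and a: "transitive_point X T a" and b: "transitive_point Y S b"
  shows "fst ` joint_orbit_closure X T a Y S b = topspace X"
proof
  let ?W = "joint_orbit_closure X T a Y S b"
  show "fst ` ?W \<subseteq> topspace X"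
    using joint_orbit_closure_subset[of X T a Y S b] by auto
  have "compact_space (prod_topology X Y)"
    using X Y by (simp add: dyn_system_def compact_space_prod_topology)
  then have "compactin (prod_topology X Y) ?W"
    unfolding joint_orbit_closure_def by (simp add: closedin_compact_space)
  then have "closedin X (fst ` ?W)"
    using X by (metis compactin_imp_closedin continuous_map_fst dyn_system_def image_compactin)
  moreover have "range (\<lambda>g. T g a) \<subseteq> fst ` ?W"
  proof -
    have "range (\<lambda>g. (T g a, S g b)) \<subseteq> ?W"
      unfolding joint_orbit_closure_def
      by (rule closure_of_subset)
        (use X Y a b in \<open>auto simp: transitive_point_def intro: dyn_system_mapsto\<close>)
    then show ?thesis by force
  qed
  ultimately show "topspace X \<subseteq> fst ` ?W"
    using a closure_of_minimal unfolding transitive_point_def by metis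
qed

text \<open>The product map of \<open>T g\<close> and \<open>S g\<close> sends the joint orbit into
  itself, the time \<open>h\<close> becoming \<open>g * h\<close>; by continuity it then sends the
  closure into itself.\<close>

lemma joint_orbit_closure_invariant:
  fixes T :: "'g::monoid_mult \<Rightarrow> 'x \<Rightarrow> 'x"
  assumes X: "dyn_system X T" and Y: "dyn_system Y S"
    and a: "a \<in> topspace X" and b: "b \<in> topspace Y"
    and W: "(x, y) \<in> joint_orbit_closure X T a Y S b"
  shows "(T g x, S g y) \<in> joint_orbit_closure X T a Y S b"
proof -
  let ?m = "\<lambda>(x, y). (T g x, S g y)" and ?O = "range (\<lambda>g. (T g a, S g b))"
  have "continuous_map (prod_topology X Y) (prod_topology X Y) ?m"
    using X Y by (simp add: continuous_map_prod_top dyn_system_def)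
  then have "?m ` (prod_topology X Y closure_of ?O) \<subseteq> prod_topology X Y closure_of (?m ` ?O)"
    by (rule continuous_map_image_closure_subset)
  also have "\<dots> \<subseteq> prod_topology X Y closure_of ?O"
  proof (rule closure_of_mono)
    have "?m (T h a, S h b) = (T (g * h) a, S (g * h) b)" for h
      using X Y a b by (simp add: dyn_system_def)
    then show "?m ` ?O \<subseteq> ?O" by auto
  qed
  finally show ?thesis
    using W unfolding joint_orbit_closure_def by auto
qed

section \<open>Factor maps from single-valued orbit closures\<close>

text \<open>Single-valuedness makes the first projection of the compact closure a continuous
  bijection onto the Hausdorff space \<open>X\<close>, hence a homeomorphism; \<phi> is its inverse
  followed by the second projection. The graph property is exported because injectivity of \<phi> is
  later derived from it.\<close>

lemma factor_map_joint_orbit_closure: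
  assumes X: "dyn_system X T" and Y: "dyn_system Y S"
    and a: "transitive_point X T a" and b: "transitive_point Y S b"
    and sv: "single_valued (joint_orbit_closure X T a Y S b)"
  obtains \<phi> where "factor_map X T Y S \<phi>"
    and "\<And>x. x \<in> topspace X \<Longrightarrow> (x, \<phi> x) \<in> joint_orbit_closure X T a Y S b"
proof -
  let ?W = "joint_orbit_closure X T a Y S b"
  let ?Z = "subtopology (prod_topology X Y) ?W"
  have uniq: "(x, y) \<in> ?W \<Longrightarrow> (x, y') \<in> ?W \<Longrightarrow> y = y'" for x y y'
    using sv by (rule single_valuedD)
  have subW: "?W \<subseteq> topspace X \<times> topspace Y"
    by (rule joint_orbit_closure_subset)
  have topZ: "topspace ?Z = ?W"
    using subW by auto
  have surj: "fst ` ?W = topspace X"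
    using joint_orbit_closure_fst[OF X Y a b] .
  have "homeomorphic_map ?Z X fst"
  proof (rule continuous_imp_homeomorphic_map)
    show "continuous_map ?Z X fst"
      by (intro continuous_map_from_subtopology continuous_map_fst)
    have "compact_space (prod_topology X Y)"
      using X Y by (simp add: dyn_system_def compact_space_prod_topology)
    then show "compact_space ?Z"
      unfolding joint_orbit_closure_def
      by (simp add: closedin_compact_space compact_space_subtopology)
    show "Hausdorff_space X" using X by (simp add: dyn_system_def)
    show "fst ` topspace ?Z = topspace X" using surj topZ by simp
    show "inj_on fst (topspace ?Z)"
      unfolding topZ by (rule inj_onI) (metis prod.collapse uniq)
  qed
  then obtain s where s: "homeomorphic_maps ?Z X fst s"
    by (auto simp: homeomorphic_map_maps)
  define \<phi> where "\<phi> = snd \<circ> s"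
  have graph: "(x, \<phi> x) \<in> ?W" if "x \<in> topspace X" for x
  proof -
    have "s x \<in> ?W"
      using s that topZ continuous_map_image_subset_topspace unfolding homeomorphic_maps_def by blast
    moreover have "fst (s x) = x"
      using s that by (simp add: homeomorphic_maps_def)
    ultimately show ?thesis
      unfolding \<phi>_def by (metis comp_apply prod.collapse)
  qed
  have "continuous_map X Y \<phi>"
    unfolding \<phi>_def
  proof (rule continuous_map_compose)
    show "continuous_map X ?Z s" using s by (simp add: homeomorphic_maps_def)
    show "continuous_map ?Z Y snd"
      by (intro continuous_map_from_subtopology continuous_map_snd)
  qed
  moreover have "\<phi> ` topspace X = topspace Y"
  proof
    show "\<phi> ` topspace X \<subseteq> topspace Y" using graph subW by auto
    show "topspace Y \<subseteq> \<phi> ` topspace X"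
    proof
      fix y assume "y \<in> topspace Y"
      \<comment> \<open>Surjectivity of the second projection is that of the first with the two
        systems exchanged.\<close>
      then obtain x where "(y, x) \<in> joint_orbit_closure Y S b X T a"
        using joint_orbit_closure_fst[OF Y X b a] by force
      then have xy: "(x, y) \<in> ?W" by (rule joint_orbit_closure_swap)
      then have x: "x \<in> topspace X" using subW by auto
      then show "y \<in> \<phi> ` topspace X" using uniq[OF xy graph] by blast
    qed
  qed
  moreover have "\<phi> (T g x) = S g (\<phi> x)" if x: "x \<in> topspace X" for g x
  \<comment> \<open>Both sides are partners of \<open>T g x\<close> in the closure: one by the graph
    property, the other by invariance.\<close>
  proof (rule uniq)
    show "(T g x, \<phi> (T g x)) \<in> ?W" by (rule graph[OF dyn_system_mapsto[OF X x]])
    show "(T g x, S g (\<phi> x)) \<in> ?W"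
      using a b graph[OF x] by (simp add: joint_orbit_closure_invariant[OF X Y] transitive_point_def)
  qed
  ultimately have "factor_map X T Y S \<phi>"
    using X Y by (simp add: factor_map_def)
  then show ?thesis using graph by (rule that)
qed

text \<open>Both sides are continuous functions on the product with values in a Hausdorff space. At
  the orbit point of time \<open>h\<close> both equal \<open>f i (g * h)\<close>, so they agree on
  the closure.\<close>

lemma represents_eq_on_joint_orbit_closure:
  fixes T :: "'g::monoid_mult \<Rightarrow> 'x \<Rightarrow> 'x"
  assumes X: "dyn_system X T" and Y: "dyn_system Y S"
    and F: "represents l f X T F a" and H: "represents l f Y S H b"
    and W: "(x, y) \<in> joint_orbit_closure X T a Y S b" and i: "i \<in> {1..l}"
  shows "F i (T g x) = H i (S g y)"
proof -
  have a: "a \<in> topspace X" and b: "b \<in> topspace Y"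
    using F H by (auto simp: represents_def transitive_point_def)
  have "(F i \<circ> T g \<circ> fst) (x, y) = (H i \<circ> S g \<circ> snd) (x, y)"
  proof (rule forall_in_closure_of_eq[where Y = euclidean
        and f = "F i \<circ> T g \<circ> fst" and g = "H i \<circ> S g \<circ> snd"])
    show "(x, y) \<in> prod_topology X Y closure_of (range (\<lambda>g. (T g a, S g b)))"
      using W by (simp add: joint_orbit_closure_def)
    show "Hausdorff_space (euclidean :: complex topology)" by simp
    show "continuous_map (prod_topology X Y) euclidean (F i \<circ> T g \<circ> fst)"
      using X F i unfolding represents_def dyn_system_def
      by (intro continuous_map_compose[where X' = X] continuous_map_fst) auto
    show "continuous_map (prod_topology X Y) euclidean (H i \<circ> S g \<circ> snd)"
      using Y H i unfolding represents_def dyn_system_def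
      by (intro continuous_map_compose[where X' = Y] continuous_map_snd) auto
    fix z assume "z \<in> range (\<lambda>g. (T g a, S g b))"
    then obtain h where z: "z = (T h a, S h b)" by auto
    have "F i (T (g * h) a) = H i (S (g * h) b)"
      using F H i by (simp add: represents_def)
    moreover have "T (g * h) a = T g (T h a)" "S (g * h) b = S g (S h b)"
      using X Y a b by (simp_all add: dyn_system_def)
    ultimately show "(F i \<circ> T g \<circ> fst) z = (H i \<circ> S g \<circ> snd) z"
      by (simp add: z)
  qed
  then show ?thesis by simp
qed

text \<open>Two partners \<open>y\<close> and \<open>y'\<close> of the same \<open>x\<close> satisfy
  \<open>H i (S g y) = F i (T g x) = H i (S g y')\<close> for all \<open>g\<close> and
  \<open>i\<close>, which separation in \<open>Y\<close> forbids unless they coincide.\<close>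

lemma separates_points_imp_single_valued:
  fixes T :: "'g::monoid_mult \<Rightarrow> 'x \<Rightarrow> 'x"
  assumes X: "dyn_system X T" and Y: "dyn_system Y S"
    and F: "represents l f X T F a" and H: "represents l f Y S H b"
    and sep: "separates_points l Y S H"
  shows "single_valued (joint_orbit_closure X T a Y S b)"
proof (rule single_valuedI)
  fix x y y'
  assume W: "(x, y) \<in> joint_orbit_closure X T a Y S b" "(x, y') \<in> joint_orbit_closure X T a Y S b"
  have "y \<in> topspace Y" "y' \<in> topspace Y"
    using W joint_orbit_closure_subset[of X T a Y S b] by auto
  moreover have "H i (S g y) = H i (S g y')" if "i \<in> {1..l}" for i g
    using represents_eq_on_joint_orbit_closure[OF X Y F H _ that] W by metis
  ultimately show "y = y'"
    using sep unfolding separates_points_def by blast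
qed

section \<open>Factors and isomorphisms of Furstenberg systems\<close>

lemma joint_furstenberg_system_factor_of_gen:
  assumes "joint_furstenberg_system l f Y S" "gen_joint_furstenberg_system l f X T"
  shows "is_factor_of Y S X T"
proof -
  obtain F a where X: "dyn_system X T" and F: "represents l f X T F a"
    using assms(2) by (auto simp: gen_joint_furstenberg_system_def)
  obtain H b where Y: "dyn_system Y S" and H: "represents l f Y S H b" and sep: "separates_points l Y S H"
    using assms(1) by (auto simp: joint_furstenberg_system_def)
  have "transitive_point X T a" "transitive_point Y S b"
    using F H by (auto simp: represents_def)
  from factor_map_joint_orbit_closure[OF X Y this separates_points_imp_single_valued[OF X Y F H sep]]
  show ?thesis unfolding is_factor_of_def by blast
qed

text \<open>Separation in \<open>Y\<close> yields a factor map \<phi> with graph in the joint orbit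
  closure. Separation in \<open>X\<close> makes the swapped closure single-valued too, so \<phi> is
  injective, and compactness turns it into a homeomorphism.\<close>

lemma joint_furstenberg_systems_isomorphic:
  assumes "joint_furstenberg_system l f X T" "joint_furstenberg_system l f Y S"
  shows "topologically_isomorphic X T Y S"
proof -
  obtain F a where X: "dyn_system X T" and F: "represents l f X T F a" and sepX: "separates_points l X T F"
    using assms(1) by (auto simp: joint_furstenberg_system_def)
  obtain H b where Y: "dyn_system Y S" and H: "represents l f Y S H b" and sepY: "separates_points l Y S H"
    using assms(2) by (auto simp: joint_furstenberg_system_def)
  let ?W = "joint_orbit_closure X T a Y S b"
  have "transitive_point X T a" "transitive_point Y S b"
    using F H by (auto simp: represents_def)
  from factor_map_joint_orbit_closure[OF X Y this separates_points_imp_single_valued[OF X Y F H sepY]]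
  obtain \<phi> where \<phi>: "factor_map X T Y S \<phi>" and graph: "\<And>x. x \<in> topspace X \<Longrightarrow> (x, \<phi> x) \<in> ?W"
    by blast
  have "inj_on \<phi> (topspace X)"
  proof (rule inj_onI)
    fix x x' assume x: "x \<in> topspace X" "x' \<in> topspace X" and eq: "\<phi> x = \<phi> x'"
    have "(\<phi> x, x) \<in> joint_orbit_closure Y S b X T a" "(\<phi> x, x') \<in> joint_orbit_closure Y S b X T a"
      using graph[OF x(1)] graph[OF x(2)] eq by (auto intro: joint_orbit_closure_swap)
    then show "x = x'"
      by (rule single_valuedD[OF separates_points_imp_single_valued[OF Y X H F sepX]])
  qed
  then have "homeomorphic_map X Y \<phi>"
    using \<phi> by (intro continuous_imp_homeomorphic_map) (auto simp: factor_map_def dyn_system_def)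
  then show ?thesis using \<phi> unfolding topologically_isomorphic_def by blast
qed

section \<open>Transport along a topological isomorphism\<close>

text \<open>A homeomorphism commutes with closures and \<phi> carries the orbit of \<open>a\<close>
  onto that of \<open>\<phi> a\<close>. The inverse \<psi> is a parameter so that representation and
  separation are transferred for the same functions \<open>F i \<circ> \<psi>\<close>.\<close>

lemma isomorphism_transfers_represents:
  fixes T :: "'g::monoid_mult \<Rightarrow> 'x \<Rightarrow> 'x"
  assumes \<phi>: "factor_map X T Y S \<phi>" and inv: "homeomorphic_maps X Y \<phi> \<psi>"
    and F: "represents l f X T F a"
  shows "represents l f Y S (\<lambda>i. F i \<circ> \<psi>) (\<phi> a)"
proof -
  have a: "a \<in> topspace X" and dense: "X closure_of (range (\<lambda>g. T g a)) = topspace X"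
    using F by (auto simp: represents_def transitive_point_def)
  have X: "dyn_system X T" and surj: "\<phi> ` topspace X = topspace Y"
    and equiv: "\<And>g x. x \<in> topspace X \<Longrightarrow> \<phi> (T g x) = S g (\<phi> x)"
    using \<phi> by (auto simp: factor_map_def)
  have orbit: "range (\<lambda>g. T g a) \<subseteq> topspace X"
    using X a by (auto intro: dyn_system_mapsto)
  have "\<phi> ` range (\<lambda>g. T g a) = range (\<lambda>g. S g (\<phi> a))"
    using equiv a by (simp add: image_image)
  moreover have "Y closure_of (\<phi> ` range (\<lambda>g. T g a)) = \<phi> ` topspace X"
    using homeomorphic_map_closure_of[OF _ orbit] inv dense by (metis homeomorphic_map_maps)
  ultimately have "transitive_point Y S (\<phi> a)"
    using a surj by (auto simp: transitive_point_def)
  moreover have "F i (\<psi> (S g (\<phi> a))) = f i g" if "i \<in> {1..l}" for g i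
  proof -
    have "\<psi> (S g (\<phi> a)) = T g a"
      using inv orbit a equiv[OF a, of g] unfolding homeomorphic_maps_def by (metis range_subsetD)
    then show ?thesis using F that by (simp add: represents_def)
  qed
  moreover have "continuous_map Y euclidean (F i \<circ> \<psi>)" if "i \<in> {1..l}" for i
    using F inv that unfolding represents_def homeomorphic_maps_def
    by (intro continuous_map_compose[where X' = X]) auto
  ultimately show ?thesis by (simp add: represents_def)
qed

lemma isomorphism_transfers_separates_points:
  fixes T :: "'g::monoid_mult \<Rightarrow> 'x \<Rightarrow> 'x"
  assumes \<phi>: "factor_map X T Y S \<phi>" and inv: "homeomorphic_maps X Y \<phi> \<psi>"
    and sep: "separates_points l X T F"
  shows "separates_points l Y S (\<lambda>i. F i \<circ> \<psi>)"
  unfolding separates_points_def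
proof (intro ballI impI)
  fix y y' assume y: "y \<in> topspace Y" "y' \<in> topspace Y" and "y \<noteq> y'"
  have \<psi>: "\<psi> z \<in> topspace X" "\<phi> (\<psi> z) = z" if "z \<in> topspace Y" for z
    using inv that continuous_map_image_subset_topspace unfolding homeomorphic_maps_def by blast+
  have shift: "\<psi> (S g z) = T g (\<psi> z)" if "z \<in> topspace Y" for g z
  proof -
    \<comment> \<open>Equivariance of \<psi> is obtained by applying it to the equivariance of
      \<phi> at the point \<open>\<psi> z\<close>.\<close>
    have "T g (\<psi> z) \<in> topspace X" and "\<phi> (T g (\<psi> z)) = S g z"
      using \<phi> \<psi>[OF that] by (auto simp: factor_map_def intro: dyn_system_mapsto)
    then show ?thesis using inv by (metis homeomorphic_maps_def)
  qed
  have "\<psi> y \<noteq> \<psi> y'" using \<psi>(2) y \<open>y \<noteq> y'\<close> by metis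
  then obtain g i where "i \<in> {1..l}" "F i (T g (\<psi> y)) \<noteq> F i (T g (\<psi> y'))"
    using sep \<psi>(1) y unfolding separates_points_def by metis
  then show "\<exists>g. \<exists>i\<in>{1..l}. (F i \<circ> \<psi>) (S g y) \<noteq> (F i \<circ> \<psi>) (S g y')"
    using shift[OF y(1)] shift[OF y(2)] unfolding comp_apply by metis
qed

lemma isomorphic_gen_joint_furstenberg_system:
  assumes "topologically_isomorphic X T Y S" "gen_joint_furstenberg_system l f X T"
  shows "gen_joint_furstenberg_system l f Y S"
proof -
  obtain \<phi> \<psi> where \<phi>: "factor_map X T Y S \<phi>" "homeomorphic_maps X Y \<phi> \<psi>"
    using assms(1) by (auto simp: topologically_isomorphic_def homeomorphic_map_maps)
  obtain F a where "represents l f X T F a"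
    using assms(2) by (auto simp: gen_joint_furstenberg_system_def)
  then have "represents l f Y S (\<lambda>i. F i \<circ> \<psi>) (\<phi> a)"
    by (rule isomorphism_transfers_represents[OF \<phi>])
  moreover have "dyn_system Y S" using \<phi>(1) by (simp add: factor_map_def)
  ultimately show ?thesis unfolding gen_joint_furstenberg_system_def by blast
qed

lemma isomorphic_joint_furstenberg_system:
  assumes "topologically_isomorphic X T Y S" "joint_furstenberg_system l f X T"
  shows "joint_furstenberg_system l f Y S"
proof -
  obtain \<phi> \<psi> where \<phi>: "factor_map X T Y S \<phi>" "homeomorphic_maps X Y \<phi> \<psi>"
    using assms(1) by (auto simp: topologically_isomorphic_def homeomorphic_map_maps)
  obtain F a where F: "represents l f X T F a" and sep: "separates_points l X T F"
    using assms(2) by (auto simp: joint_furstenberg_system_def)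
  have "represents l f Y S (\<lambda>i. F i \<circ> \<psi>) (\<phi> a)"
    using F by (rule isomorphism_transfers_represents[OF \<phi>])
  moreover have "separates_points l Y S (\<lambda>i. F i \<circ> \<psi>)"
    using sep by (rule isomorphism_transfers_separates_points[OF \<phi>])
  moreover have "dyn_system Y S" using \<phi>(1) by (simp add: factor_map_def)
  ultimately show ?thesis unfolding joint_furstenberg_system_def by blast
qed

section \<open>The system \<open>\<beta>G\<close>\<close>

text \<open>Zorn's lemma gives a maximal family with the finite intersection property that contains
  \<open>\<C>\<close>; maximality makes it an ultrafilter.\<close>

lemma ultrafilter_exists:
  assumes fip: "\<And>\<F>. finite \<F> \<Longrightarrow> \<F> \<subseteq> \<C> \<Longrightarrow> \<Inter>\<F> \<noteq> {}"
  obtains p where "ultrafilter p" "\<C> \<subseteq> p"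
proof -
  let ?\<A> = "{\<D>. \<C> \<subseteq> \<D> \<and> (\<forall>\<F>. finite \<F> \<and> \<F> \<subseteq> \<D> \<longrightarrow> \<Inter>\<F> \<noteq> {})}"
  have "\<exists>M\<in>?\<A>. \<forall>D\<in>?\<A>. M \<subseteq> D \<longrightarrow> D = M"
  proof (rule subset_Zorn_nonempty)
    show "?\<A> \<noteq> {}" using fip by blast
    fix \<K> assume ne: "\<K> \<noteq> {}" and chain: "subset.chain ?\<A> \<K>"
    have sub: "\<K> \<subseteq> ?\<A>" using chain by (simp add: subset_chain_def)
    have "\<Inter>\<F> \<noteq> {}" if \<F>: "finite \<F>" "\<F> \<subseteq> \<Union>\<K>" for \<F>
    proof -
      obtain D where "D \<in> \<K>" "\<F> \<subseteq> D"
        using finite_subset_Union_chain[OF \<F> ne chain] by blast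
      then show ?thesis using sub \<F>(1) by blast
    qed
    moreover have "\<C> \<subseteq> \<Union>\<K>" using ne sub by blast
    ultimately show "\<Union>\<K> \<in> ?\<A>" by blast
  qed
  then obtain M where M: "M \<in> ?\<A>" and max: "\<forall>D\<in>?\<A>. M \<subseteq> D \<longrightarrow> D = M"
    by (rule bexE)
  have \<C>M: "\<C> \<subseteq> M" and fipM: "\<And>\<F>. finite \<F> \<Longrightarrow> \<F> \<subseteq> M \<Longrightarrow> \<Inter>\<F> \<noteq> {}"
    using M by simp_all
  \<comment> \<open>A set that meets all finite intersections from \<open>M\<close> can be added
    without losing the finite intersection property, so maximality puts it in \<open>M\<close>. All
    the positive ultrafilter axioms are checked through this criterion.\<close>
  have mem: "B \<in> M" if B: "\<And>\<F>. finite \<F> \<Longrightarrow> \<F> \<subseteq> M \<Longrightarrow> B \<inter> \<Inter>\<F> \<noteq> {}" for B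
  proof -
    have "\<Inter>\<F> \<noteq> {}" if \<F>: "finite \<F>" "\<F> \<subseteq> insert B M" for \<F>
    proof -
      have "B \<inter> \<Inter>(\<F> - {B}) \<noteq> {}" using \<F> by (intro B) auto
      then show ?thesis by auto
    qed
    then have "insert B M \<in> ?\<A>" using \<C>M by auto
    then have "insert B M = M" using max by (meson subset_insertI)
    then show ?thesis by blast
  qed
  have "ultrafilter M"
    unfolding ultrafilter_def
  proof (intro conjI allI impI)
    show "UNIV \<in> M" using fipM by (intro mem) simp
    show "{} \<notin> M" using fipM[of "{{}}"] by auto
    fix A B
    show "B \<in> M" if "A \<in> M \<and> A \<subseteq> B"
    proof (rule mem)
      fix \<F> assume "finite \<F>" "\<F> \<subseteq> M"
      then show "B \<inter> \<Inter>\<F> \<noteq> {}" using fipM[of "insert A \<F>"] that by auto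
    qed
    show "A \<inter> B \<in> M" if "A \<in> M \<and> B \<in> M"
    proof (rule mem)
      fix \<F> assume "finite \<F>" "\<F> \<subseteq> M"
      then show "A \<inter> B \<inter> \<Inter>\<F> \<noteq> {}" using fipM[of "insert A (insert B \<F>)"] that by (simp add: Int_assoc)
    qed
    show "A \<in> M \<or> - A \<in> M"
    proof (rule disjCI)
      assume "- A \<notin> M"
      \<comment> \<open>The criterion fails for \<open>- A\<close>, so some finite intersection from
        \<open>M\<close> lies inside \<open>A\<close>; hence \<open>A\<close> itself meets the
        criterion.\<close>
      then obtain \<F> where \<F>: "finite \<F>" "\<F> \<subseteq> M" "- A \<inter> \<Inter>\<F> = {}" using mem by metis
      show "A \<in> M"
      proof (rule mem)
        fix \<G> assume "finite \<G>" "\<G> \<subseteq> M"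
        then have "\<Inter>(\<F> \<union> \<G>) \<noteq> {}" using \<F> by (intro fipM) auto
        then show "A \<inter> \<Inter>\<G> \<noteq> {}" using \<F>(3) by auto
      qed
    qed
  qed
  then show ?thesis using \<C>M that by blast
qed

lemma ultrafilter_mono: "ultrafilter p \<Longrightarrow> A \<in> p \<Longrightarrow> A \<subseteq> B \<Longrightarrow> B \<in> p"
  unfolding ultrafilter_def by blast

lemma ultrafilter_Compl:
  "ultrafilter p \<Longrightarrow> - A \<in> p \<longleftrightarrow> A \<notin> p"
  unfolding ultrafilter_def by (metis Compl_disjoint)

lemma ultrafilter_Inter:
  assumes "ultrafilter p" "finite \<F>" "\<F> \<subseteq> p"
  shows "\<Inter>\<F> \<in> p"
  using assms(2,3) by induction (use assms(1) in \<open>auto simp: ultrafilter_def\<close>)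

lemma ultrafilter_principal_uf: "ultrafilter (principal_uf g)"
  by (auto simp: ultrafilter_def principal_uf_def)

text \<open>Taking preimages under left multiplication by \<open>g\<close> is monotone and commutes
  with intersections and complements, so each axiom is inherited from \<open>q\<close>.\<close>

lemma ultrafilter_beta_shift:
  assumes "ultrafilter q"
  shows "ultrafilter (beta_shift g q)"
proof -
  have 1: "{h. g * h \<in> A \<inter> B} = {h. g * h \<in> A} \<inter> {h. g * h \<in> B}"
    and 2: "{h. g * h \<in> - A} = - {h. g * h \<in> A}"
    and 3: "A \<subseteq> B \<Longrightarrow> {h. g * h \<in> A} \<subseteq> {h. g * h \<in> B}" for A B
    by auto
  show ?thesis
    unfolding ultrafilter_def beta_shift_eq mem_Collect_eq 1 2
  proof (intro conjI allI impI)
    show "{h. g * h \<in> UNIV} \<in> q" "{h. g * h \<in> {}} \<notin> q"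
      using assms by (simp_all add: ultrafilter_def)
    fix A B
    show "{h. g * h \<in> B} \<in> q" if "{h. g * h \<in> A} \<in> q \<and> A \<subseteq> B"
      using that 3 ultrafilter_mono[OF assms] by metis
    show "{h. g * h \<in> A} \<inter> {h. g * h \<in> B} \<in> q" if "{h. g * h \<in> A} \<in> q \<and> {h. g * h \<in> B} \<in> q"
      using that assms by (simp add: ultrafilter_def)
    show "{h. g * h \<in> A} \<in> q \<or> - {h. g * h \<in> A} \<in> q"
      using assms by (simp add: ultrafilter_def)
  qed
qed

section \<open>Base, compactness and separation of the topology\<close>

lemma openin_beta_cylinder: "openin beta_topology {q. ultrafilter q \<and> A \<in> q}"
  unfolding beta_topology_def by (rule topology_generated_by_Basis) auto

text \<open>The generating sets form a base and not merely a subbase, because the sets belonging to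
  \<open>A\<close> and to \<open>B\<close> intersect in the one belonging to
  \<open>A \<inter> B\<close>.\<close>

lemma openin_beta_topology_basic:
  assumes "openin beta_topology U" "p \<in> U"
  obtains A where "A \<in> p" "{q. ultrafilter q \<and> A \<in> q} \<subseteq> U"
proof -
  have "generate_topology_on (range (\<lambda>A. {p. ultrafilter p \<and> A \<in> p})) U"
    using assms(1) by (simp add: beta_topology_def openin_topology_generated_by_iff)
  then have "p \<in> U \<longrightarrow> (\<exists>A\<in>p. {q. ultrafilter q \<and> A \<in> q} \<subseteq> U)" for p
  proof induction
    case (Int U V)
    show ?case
    proof
      assume "p \<in> U \<inter> V"
      then obtain A B where AB: "A \<in> p" "{q. ultrafilter q \<and> A \<in> q} \<subseteq> U"
        "B \<in> p" "{q. ultrafilter q \<and> B \<in> q} \<subseteq> V"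
        using Int.IH by auto
      have "generate_topology_on (range (\<lambda>A. {p. ultrafilter p \<and> A \<in> p})) (U \<inter> V)"
        using Int.hyps by (rule generate_topology_on.Int)
      \<comment> \<open>That \<open>p\<close> is an ultrafilter, needed for
        \<open>A \<inter> B \<in> p\<close>, is read off from its lying in an open set.\<close>
      then have "U \<inter> V \<subseteq> topspace beta_topology"
        unfolding beta_topology_def by (intro openin_subset) (simp add: openin_topology_generated_by_iff)
      then have "ultrafilter p"
        using \<open>p \<in> U \<inter> V\<close> by (auto simp: topspace_beta_topology)
      then have "A \<inter> B \<in> p" using AB by (simp add: ultrafilter_def)
      moreover have "{q. ultrafilter q \<and> A \<inter> B \<in> q} \<subseteq> U \<inter> V"
        using AB ultrafilter_mono[of _ "A \<inter> B"] by (auto simp: subset_iff)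
      ultimately show "\<exists>A\<in>p. {q. ultrafilter q \<and> A \<in> q} \<subseteq> U \<inter> V" by blast
    qed
  next
    case (UN \<K>)
    then show ?case by (meson Sup_upper UnionE order_trans)
  qed auto
  then show ?thesis using assms(2) that by blast
qed

lemma compact_space_beta_topology: "compact_space (beta_topology :: 'g set set topology)"
  unfolding compact_space_alt
proof (intro allI impI)
  fix \<U> :: "'g set set set set"
  assume "(\<forall>U\<in>\<U>. openin beta_topology U) \<and> topspace beta_topology \<subseteq> \<Union>\<U>"
  then have op: "\<forall>U\<in>\<U>. openin beta_topology U" and cover: "topspace beta_topology \<subseteq> \<Union>\<U>"
    by simp_all
  let ?cyl = "\<lambda>A. {q :: 'g set set. ultrafilter q \<and> A \<in> q}"
  \<comment> \<open>These are the complements of the sets whose cylinder lies in a single member of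
    the cover. An ultrafilter containing all of \<open>\<C>\<close> would escape the cover, so
    \<open>\<C>\<close> lacks the finite intersection property.\<close>
  define \<C> where "\<C> = {A. \<exists>U\<in>\<U>. ?cyl (- A) \<subseteq> U}"
  have "\<not> (\<forall>\<F>. finite \<F> \<longrightarrow> \<F> \<subseteq> \<C> \<longrightarrow> \<Inter>\<F> \<noteq> {})"
  proof
    assume "\<forall>\<F>. finite \<F> \<longrightarrow> \<F> \<subseteq> \<C> \<longrightarrow> \<Inter>\<F> \<noteq> {}"
    then obtain p where p: "ultrafilter p" "\<C> \<subseteq> p"
      using ultrafilter_exists[of \<C>] by metis
    then have "p \<in> \<Union>\<U>"
      using cover by (auto simp: topspace_beta_topology)
    then obtain U where U: "U \<in> \<U>" "p \<in> U" ..
    then obtain A where A: "A \<in> p" "?cyl A \<subseteq> U"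
      using op openin_beta_topology_basic by metis
    then have "- A \<in> \<C>" using U by (auto simp: \<C>_def)
    then show False using p A by (metis subsetD ultrafilter_Compl)
  qed
  then obtain \<F> where \<F>: "finite \<F>" "\<F> \<subseteq> \<C>" "\<Inter>\<F> = {}" by metis
  have "\<forall>A\<in>\<F>. \<exists>U. U \<in> \<U> \<and> ?cyl (- A) \<subseteq> U" using \<F>(2) by (auto simp: \<C>_def)
  then obtain u where u: "\<forall>A\<in>\<F>. u A \<in> \<U> \<and> ?cyl (- A) \<subseteq> u A" by (rule bchoice[THEN exE])
  \<comment> \<open>As \<open>\<F>\<close> is finite with empty intersection, every ultrafilter
    omits some \<open>A\<close> in \<open>\<F>\<close>, hence contains \<open>- A\<close> and lies
    in \<open>u A\<close>.\<close>
  have "topspace beta_topology \<subseteq> \<Union>(u ` \<F>)"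
  proof
    fix q :: "'g set set" assume "q \<in> topspace beta_topology"
    then have q: "ultrafilter q" by (simp add: topspace_beta_topology)
    then have "\<Inter>\<F> \<notin> q" using \<F>(3) by (simp add: ultrafilter_def)
    then have "\<not> \<F> \<subseteq> q" using ultrafilter_Inter[OF q \<F>(1)] by metis
    then obtain A where "A \<in> \<F>" "- A \<in> q" using ultrafilter_Compl[OF q] by auto
    then show "q \<in> \<Union>(u ` \<F>)" using u q by blast
  qed
  then show "\<exists>\<V>. finite \<V> \<and> \<V> \<subseteq> \<U> \<and> topspace beta_topology \<subseteq> \<Union>\<V>"
    using \<F>(1) u by (intro exI[of _ "u ` \<F>"]) auto
qed

text \<open>Distinct ultrafilters disagree on some \<open>A\<close>, and the cylinders of
  \<open>A\<close> and \<open>- A\<close> are disjoint.\<close>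

lemma Hausdorff_space_beta_topology: "Hausdorff_space beta_topology"
  unfolding Hausdorff_space_def
proof (intro allI impI)
  fix p q :: "'a set set"
  assume "p \<in> topspace beta_topology \<and> q \<in> topspace beta_topology \<and> p \<noteq> q"
  then have pq: "ultrafilter p" "ultrafilter q" "p \<noteq> q" by (auto simp: topspace_beta_topology)
  then obtain A where A: "A \<in> p" "- A \<in> q"
    using ultrafilter_Compl[OF pq(1)] ultrafilter_Compl[OF pq(2)] by (metis double_complement subsetI subset_antisym)
  show "\<exists>U V. openin beta_topology U \<and> openin beta_topology V \<and> p \<in> U \<and> q \<in> V \<and> disjnt U V"
  proof (intro exI conjI)
    show "openin beta_topology {p. ultrafilter p \<and> A \<in> p}"
      "openin beta_topology {p. ultrafilter p \<and> - A \<in> p}"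
      by (rule openin_beta_cylinder)+
    show "disjnt {p. ultrafilter p \<and> A \<in> p} {p. ultrafilter p \<and> - A \<in> p}"
      by (auto simp: disjnt_def ultrafilter_Compl)
  qed (use pq A in auto)
qed

section \<open>The shift action and its transitive factors\<close>

lemma dyn_system_beta: "dyn_system beta_topology beta_shift"
  unfolding dyn_system_def
proof (intro conjI allI ballI)
  show "continuous_map beta_topology beta_topology (beta_shift g)" for g :: "'a::monoid_mult"
    unfolding beta_topology_def[where 'g = 'a]
  proof (rule continuous_on_generated_topo, fold beta_topology_def)
    fix U assume "U \<in> range (\<lambda>A. {p :: 'a set set. ultrafilter p \<and> A \<in> p})"
    then obtain A where U: "U = {p. ultrafilter p \<and> A \<in> p}" by auto
    \<comment> \<open>The preimage of a generating cylinder is again a cylinder, which suffices for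
      continuity.\<close>
    have "beta_shift g -` U \<inter> topspace beta_topology = {q. ultrafilter q \<and> {h. g * h \<in> A} \<in> q}"
      using ultrafilter_beta_shift by (auto simp: U topspace_beta_topology beta_shift_eq)
    then show "openin beta_topology (beta_shift g -` U \<inter> topspace beta_topology)"
      by (simp add: openin_beta_cylinder)
  next
    show "beta_shift g ` topspace beta_topology \<subseteq> \<Union>(range (\<lambda>A. {p :: 'a set set. ultrafilter p \<and> A \<in> p}))"
    proof
      fix p assume "p \<in> beta_shift g ` topspace beta_topology"
      then have "ultrafilter p"
        using ultrafilter_beta_shift by (auto simp: topspace_beta_topology)
      moreover from this have "UNIV \<in> p" by (simp add: ultrafilter_def)
      ultimately show "p \<in> \<Union>(range (\<lambda>A. {p. ultrafilter p \<and> A \<in> p}))" by blast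
    qed
  qed
next
  show "beta_shift (g * h) q = beta_shift g (beta_shift h q)" for g h :: 'a and q
    by (simp add: beta_shift_eq mult.assoc)
  show "beta_shift (1 :: 'a) q = q" for q
    by (simp add: beta_shift_eq)
qed (fact compact_space_beta_topology Hausdorff_space_beta_topology)+

lemma beta_shift_principal_uf: "beta_shift g (principal_uf h) = principal_uf (g * h)"
  by (simp add: beta_shift_eq principal_uf_def)

text \<open>The orbit of the identity consists of all principal ultrafilters. It is dense since the
  cylinder of a nonempty \<open>A\<close> contains the principal ultrafilter at any element of
  \<open>A\<close>.\<close>

lemma transitive_point_beta:
  "transitive_point beta_topology beta_shift (principal_uf (1 :: 'g::monoid_mult))"
proof -
  have "p \<in> beta_topology closure_of (range principal_uf)" if p: "ultrafilter p" for p :: "'g set set"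
    unfolding in_closure_of
  proof (intro conjI allI impI)
    show "p \<in> topspace beta_topology" using p by (simp add: topspace_beta_topology)
    fix U assume "p \<in> U \<and> openin beta_topology U"
    then obtain A where A: "A \<in> p" "{q. ultrafilter q \<and> A \<in> q} \<subseteq> U"
      using openin_beta_topology_basic by metis
    then have "A \<noteq> {}" using p by (auto simp: ultrafilter_def)
    then obtain g where "g \<in> A" by blast
    then have "principal_uf g \<in> U"
      using A ultrafilter_principal_uf[of g] by (auto simp: principal_uf_def)
    then show "\<exists>q. q \<in> range principal_uf \<and> q \<in> U" by blast
  qed
  then have "beta_topology closure_of (range (principal_uf :: 'g \<Rightarrow> _)) = topspace beta_topology"
    using closure_of_subset_topspace by (fastforce simp: topspace_beta_topology)
  then show ?thesis
    by (simp add: transitive_point_def beta_shift_principal_uf topspace_beta_topology ultrafilter_principal_uf)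
qed

text \<open>A partner of \<open>p\<close> in the joint orbit closure is a limit of
  \<open>T g a\<close> along \<open>p\<close>, and such limits are unique in a Hausdorff
  space.\<close>

lemma transitive_system_factor_of_beta:
  fixes T :: "'g::monoid_mult \<Rightarrow> 'x \<Rightarrow> 'x"
  assumes X: "dyn_system X T" and a: "transitive_point X T a"
  shows "is_factor_of X T (beta_topology :: 'g set set topology) beta_shift"
proof -
  let ?W = "joint_orbit_closure beta_topology beta_shift (principal_uf 1) X T a"
  have "single_valued ?W"
  proof (rule single_valuedI, rule ccontr)
    fix p x x' assume W: "(p, x) \<in> ?W" "(p, x') \<in> ?W" and "x \<noteq> x'"
    have p: "ultrafilter p" and x: "x \<in> topspace X" "x' \<in> topspace X"
      using W joint_orbit_closure_subset[of beta_topology beta_shift "principal_uf 1" X T a]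
      by (auto simp: topspace_beta_topology)
    then obtain U V where U: "openin X U" "x \<in> U" and V: "openin X V" "x' \<in> V" and "disjnt U V"
      using X \<open>x \<noteq> x'\<close> unfolding dyn_system_def Hausdorff_space_def by metis
    \<comment> \<open>The cylinder of \<open>A\<close> times \<open>V'\<close> is a neighbourhood of
      \<open>(p, z)\<close>, so it meets the joint orbit; the first coordinate there is principal at
      \<open>g\<close>, which forces \<open>g \<in> A\<close>.\<close>
    have visit: "\<exists>g\<in>A. T g a \<in> V'" if A: "A \<in> p" and V': "openin X V'" "z \<in> V'" and z: "(p, z) \<in> ?W" for A V' z
    proof -
      define B where "B = {q. ultrafilter q \<and> A \<in> q} \<times> V'"
      have "openin (prod_topology beta_topology X) B"
        using V'(1) by (simp add: B_def openin_prod_Times_iff openin_beta_cylinder)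
      moreover have "(p, z) \<in> B"
        using p A V'(2) by (simp add: B_def)
      ultimately obtain w where "w \<in> range (\<lambda>g. (beta_shift g (principal_uf 1), T g a))" "w \<in> B"
        using z unfolding joint_orbit_closure_def in_closure_of by metis
      then obtain g where "(beta_shift g (principal_uf 1), T g a) \<in> B" by auto
      then have "A \<in> principal_uf g" "T g a \<in> V'" by (simp_all add: B_def beta_shift_principal_uf)
      then show ?thesis by (auto simp: principal_uf_def)
    qed
    \<comment> \<open>The ultrafilter decides whether \<open>U\<close> is visited. If
      \<open>?A\<close> is in \<open>p\<close>, some time in \<open>?A\<close> also visits
      \<open>V\<close>, against disjointness; otherwise some time outside \<open>?A\<close> visits
      \<open>U\<close>.\<close>
    let ?A = "{g. T g a \<in> U}"
    consider "?A \<in> p" | "- ?A \<in> p" using ultrafilter_Compl[OF p] by blast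
    then show False
    proof cases
      case 1
      then show False using visit[OF 1 V W(2)] \<open>disjnt U V\<close> by (auto simp: disjnt_iff)
    next
      case 2
      then show False using visit[OF 2 U W(1)] by auto
    qed
  qed
  from factor_map_joint_orbit_closure[OF dyn_system_beta X transitive_point_beta a this]
  show ?thesis unfolding is_factor_of_def by blast
qed

theorem theorem3p4:
  fixes f :: "nat \<Rightarrow> 'g::monoid_mult \<Rightarrow> complex" and l :: nat
  assumes bounded: "\<And>i. i \<in> {1..l} \<Longrightarrow> bounded (range (f i))"
  shows
    "(\<forall>(X :: 'x topology) T (Y :: 'y topology) S.
        topologically_isomorphic X T Y S \<longrightarrow>
          (joint_furstenberg_system l f X T \<longrightarrow> joint_furstenberg_system l f Y S) \<and>
          (gen_joint_furstenberg_system l f X T \<longrightarrow> gen_joint_furstenberg_system l f Y S))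
     \<and>
     (\<forall>(X :: 'x topology) T (Y :: 'y topology) S.
        joint_furstenberg_system l f X T \<and> joint_furstenberg_system l f Y S \<longrightarrow>
          topologically_isomorphic X T Y S)
     \<and>
     (\<forall>(X :: 'x topology) T (Y :: 'y topology) S.
        joint_furstenberg_system l f Y S \<and> gen_joint_furstenberg_system l f X T \<longrightarrow>
          is_factor_of Y S X T)
     \<and>
     (\<forall>(X :: 'x topology) T.
        gen_joint_furstenberg_system l f X T \<longrightarrow>
          is_factor_of X T (beta_topology :: 'g set set topology) beta_shift)"
proof (intro conjI allI impI; (elim conjE)?)
  fix X :: "'x topology" and T :: "'g \<Rightarrow> 'x \<Rightarrow> 'x"
  assume "gen_joint_furstenberg_system l f X T"
  then show "is_factor_of X T (beta_topology :: 'g set set topology) beta_shift"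
    by (auto simp: gen_joint_furstenberg_system_def represents_def intro: transitive_system_factor_of_beta)
qed (fact isomorphic_joint_furstenberg_system isomorphic_gen_joint_furstenberg_system
    joint_furstenberg_systems_isomorphic joint_furstenberg_system_factor_of_gen)+

end
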